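(* Let $G=\mathrm{SU}(1,1)$, $G^{\mathbb{C}}=\mathrm{SL}(2,\mathbb{C})$, and let $S\subset G^{\mathbb{C}}$ be the open complex compression semigroup associated to the unit disc $\Delta$. Let $\Gamma\subset G$ be a discrete subgroup. If $G/\Gamma$ is compact, then the quotient $\Gamma\backslash S$ is not Stein.
   Context: Here $G=\mathrm{SU}(1,1)\subset \mathrm{SL}(2,\mathbb{C})=G^{\mathbb{C}}$, and $G^{\mathbb{C}}$ acts on $\mathbb{P}_1=\mathbb{P}_1(\mathbb{C})$ by its standard action on homogeneous coordinates $[z_0:z_1]$. The unit disc is identified with the open $G$-orbit $\Delta=\{[z_0:z_1]\in\mathbb{P}_1 : |z_0|^2-|z_1|^2<0\}$, with closure $\overline{\Delta}$ in $\mathbb{P}_1$. The compression semigroup is $S:=\{g\in \mathrm{SL}(2,\mathbb{C}) : g(\overline{\Delta})\subset\Delta\}$, an open subset of $\mathrm{SL}(2,\mathbb{C})$ invariant under left and right multiplication by $G$. The discrete group $\Gamma$ acts on $S$ by left multiplication, and $\Gamma\backslash S$ is the quotient complex manifold. *)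

theory Defs
  imports "HOL-Analysis.Analysis" "HOL-Algebra.Coset"
begin

definition quotient_topology :: "'a topology \<Rightarrow> ('a \<Rightarrow> 'b) \<Rightarrow> 'b topology" where
  "quotient_topology X q =
     topology (\<lambda>V. V \<subseteq> q ` topspace X \<and> openin X {x \<in> topspace X. q x \<in> V})"

lemma openin_quotient_topology:
  "openin (quotient_topology X q) V \<longleftrightarrow>
     V \<subseteq> q ` topspace X \<and> openin X {x \<in> topspace X. q x \<in> V}"
proof -
  have "istopology (\<lambda>V. V \<subseteq> q ` topspace X \<and> openin X {x \<in> topspace X. q x \<in> V})"
    unfolding istopology_def
  proof (intro conjI allI impI)
    fix V W
    assume "V \<subseteq> q ` topspace X \<and> openin X {x \<in> topspace X. q x \<in> V}"
      and "W \<subseteq> q ` topspace X \<and> openin X {x \<in> topspace X. q x \<in> W}"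
    moreover have "{x \<in> topspace X. q x \<in> V \<inter> W}
        = {x \<in> topspace X. q x \<in> V} \<inter> {x \<in> topspace X. q x \<in> W}"
      by blast
    ultimately show "V \<inter> W \<subseteq> q ` topspace X" "openin X {x \<in> topspace X. q x \<in> V \<inter> W}"
      by (auto simp: openin_Int)
  next
    fix \<V>
    assume "\<forall>V\<in>\<V>. V \<subseteq> q ` topspace X \<and> openin X {x \<in> topspace X. q x \<in> V}"
    moreover have "{x \<in> topspace X. q x \<in> \<Union>\<V>} = (\<Union>V\<in>\<V>. {x \<in> topspace X. q x \<in> V})"
      by blast
    ultimately show "\<Union>\<V> \<subseteq> q ` topspace X" "openin X {x \<in> topspace X. q x \<in> \<Union>\<V>}"
      by auto
  qed
  then show ?thesis
    by (simp add: quotient_topology_def topology_inverse')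
qed

lemma topspace_quotient_topology [simp]:
  "topspace (quotient_topology X q) = q ` topspace X"
proof -
  have "{x \<in> topspace X. q x \<in> q ` topspace X} = topspace X" by blast
  then have "openin (quotient_topology X q) (q ` topspace X)"
    by (simp add: openin_quotient_topology)
  then show ?thesis
    by (metis openin_quotient_topology openin_subset openin_topspace subset_antisym)
qed

lemma quotient_map_quotient_topology: "quotient_map X (quotient_topology X q) q"
  by (auto simp: quotient_map_def openin_quotient_topology)


section \<open>Complex manifolds and Stein manifolds\<close>

text \<open>
  Complex differentiability: the real derivative is required to be complex linear.
  The set is meant to be open.
\<close>

definition vec_holomorphic_on :: "(complex^'n::finite \<Rightarrow> complex) \<Rightarrow> (complex^'n) set \<Rightarrow> bool"
  (infixl \<open>vec'_holomorphic'_on\<close> 50) where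
  "f vec_holomorphic_on W \<longleftrightarrow>
     (\<forall>x\<in>W. \<exists>D. (f has_derivative D) (at x) \<and> (\<forall>c v. D (c *s v) = c * D v))"

text \<open>
  A complex manifold is given by a topological space \<open>X\<close> together with its sheaf of holomorphic
  functions: \<open>\<O> U f\<close> means that \<open>f\<close> is holomorphic on the open set \<open>U\<close>. Functions are total, so
  \<open>\<O> U f\<close> must depend only on the restriction of \<open>f\<close> to \<open>U\<close>.
\<close>

definition function_sheaf :: "'a topology \<Rightarrow> ('a set \<Rightarrow> ('a \<Rightarrow> complex) \<Rightarrow> bool) \<Rightarrow> bool" where
  "function_sheaf X \<O> \<longleftrightarrow>
     (\<forall>U f g. openin X U \<longrightarrow> (\<forall>x\<in>U. f x = g x) \<longrightarrow> \<O> U f \<longrightarrow> \<O> U g) \<and>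
     (\<forall>\<U> f. (\<forall>U\<in>\<U>. openin X U) \<longrightarrow> (\<O> (\<Union>\<U>) f \<longleftrightarrow> (\<forall>U\<in>\<U>. \<O> U f)))"

definition holomorphic_chart ::
  "'a topology \<Rightarrow> ('a set \<Rightarrow> ('a \<Rightarrow> complex) \<Rightarrow> bool) \<Rightarrow> 'a set \<Rightarrow> ('a \<Rightarrow> complex^'n::finite) \<Rightarrow> bool"
  where
  "holomorphic_chart X \<O> U \<phi> \<longleftrightarrow>
     openin X U \<and> open (\<phi> ` U) \<and>
     homeomorphic_map (subtopology X U) (top_of_set (\<phi> ` U)) \<phi> \<and>
     (\<forall>W h. open W \<longrightarrow> W \<subseteq> \<phi> ` U \<longrightarrow>
        (\<O> {x \<in> U. \<phi> x \<in> W} (h \<circ> \<phi>) \<longleftrightarrow> h vec_holomorphic_on W))"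

text \<open>The dimension is the cardinality of the index type \<open>'n\<close>.\<close>

definition complex_manifold ::
  "'n::finite itself \<Rightarrow> 'a topology \<Rightarrow> ('a set \<Rightarrow> ('a \<Rightarrow> complex) \<Rightarrow> bool) \<Rightarrow> bool" where
  "complex_manifold (_ :: 'n itself) X \<O> \<longleftrightarrow>
     Hausdorff_space X \<and> second_countable X \<and> function_sheaf X \<O> \<and>
     (\<forall>x \<in> topspace X. \<exists>U (\<phi> :: 'a \<Rightarrow> complex^'n). x \<in> U \<and> holomorphic_chart X \<O> U \<phi>)"

definition holomorphic_hull ::
  "'a topology \<Rightarrow> ('a set \<Rightarrow> ('a \<Rightarrow> complex) \<Rightarrow> bool) \<Rightarrow> 'a set \<Rightarrow> 'a set" where
  "holomorphic_hull X \<O> K =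
     {x \<in> topspace X. \<forall>f. \<O> (topspace X) f \<longrightarrow>
        ereal (cmod (f x)) \<le> (SUP y\<in>K. ereal (cmod (f y)))}"

definition holomorphically_convex ::
  "'a topology \<Rightarrow> ('a set \<Rightarrow> ('a \<Rightarrow> complex) \<Rightarrow> bool) \<Rightarrow> bool" where
  "holomorphically_convex X \<O> \<longleftrightarrow>
     (\<forall>K. compactin X K \<longrightarrow> compactin X (holomorphic_hull X \<O> K))"

definition holomorphically_separable ::
  "'a topology \<Rightarrow> ('a set \<Rightarrow> ('a \<Rightarrow> complex) \<Rightarrow> bool) \<Rightarrow> bool" where
  "holomorphically_separable X \<O> \<longleftrightarrow>
     (\<forall>x \<in> topspace X. \<forall>y \<in> topspace X. x \<noteq> y \<longrightarrow> (\<exists>f. \<O> (topspace X) f \<and> f x \<noteq> f y))"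

text \<open>
  The further axiom, found in some textbooks, that global functions provide local coordinates
  follows from the two axioms below.
\<close>

definition stein_manifold ::
  "'n::finite itself \<Rightarrow> 'a topology \<Rightarrow> ('a set \<Rightarrow> ('a \<Rightarrow> complex) \<Rightarrow> bool) \<Rightarrow> bool" where
  "stein_manifold n X \<O> \<longleftrightarrow>
     complex_manifold n X \<O> \<and> holomorphically_convex X \<O> \<and> holomorphically_separable X \<O>"


section \<open>The groups SL(2,C) and SU(1,1)\<close>

definition SL2 :: "(complex^2^2) monoid" where
  "SL2 = \<lparr>carrier = {A. det A = 1}, mult = (**), one = mat 1\<rparr>"

text \<open>
  The homogeneous coordinates \<open>z\<^sub>0\<close>, \<open>z\<^sub>1\<close> are the components \<open>z $ 1\<close>, \<open>z $ 2\<close> of \<open>z\<close>.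
\<close>

definition herm11 :: "complex^2 \<Rightarrow> complex^2 \<Rightarrow> complex" where
  "herm11 z w = z $ 1 * cnj (w $ 1) - z $ 2 * cnj (w $ 2)"

definition SU11 :: "(complex^2^2) monoid" where
  "SU11 = SL2\<lparr>carrier :=
     {A \<in> carrier SL2. \<forall>z w. herm11 (A *v z) (A *v w) = herm11 z w}\<rparr>"


section \<open>The projective line and the compression semigroup of the disc\<close>

text \<open>The point with homogeneous coordinates \<open>z \<noteq> 0\<close>, as the punctured line through \<open>z\<close>.\<close>

definition proj :: "complex^2 \<Rightarrow> (complex^2) set" where
  "proj z = {c *s z | c. c \<noteq> 0}"

definition P1 :: "(complex^2) set topology" where
  "P1 = quotient_topology (top_of_set (- {0})) proj"

definition P1_action :: "complex^2^2 \<Rightarrow> (complex^2) set \<Rightarrow> (complex^2) set" where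
  "P1_action g p = (\<lambda>z. g *v z) ` p"

lemma P1_action_proj: "P1_action g (proj z) = proj (g *v z)"
  unfolding P1_action_def proj_def
  by (force simp: vector_scalar_commute)

definition disc :: "(complex^2) set set" where
  "disc = {proj z | z. z \<noteq> 0 \<and> (cmod (z $ 1))\<^sup>2 - (cmod (z $ 2))\<^sup>2 < 0}"

definition compression_semigroup :: "(complex^2^2) set" where
  "compression_semigroup =
     {g \<in> carrier SL2. P1_action g ` (P1 closure_of disc) \<subseteq> disc}"


section \<open>Quotients by a discrete subgroup\<close>

definition entries :: "complex^2^2 \<Rightarrow> complex^(2 \<times> 2)" where
  "entries A = (\<chi> p. A $ fst p $ snd p)"

text \<open>
  The structure sheaf of SL(2,C) as a closed submanifold of the space of all 2 by 2 matrices: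
  the functions that locally extend to holomorphic functions of the four matrix entries.
\<close>

definition SL2_holomorphic :: "(complex^2^2) set \<Rightarrow> (complex^2^2 \<Rightarrow> complex) \<Rightarrow> bool" where
  "SL2_holomorphic U f \<longleftrightarrow>
     (\<forall>A\<in>U. \<exists>W F. open W \<and> entries A \<in> W \<and> F vec_holomorphic_on W \<and>
        (\<forall>B\<in>U. entries B \<in> W \<longrightarrow> f B = F (entries B)))"

text \<open>
  The points of the quotient of \<open>S\<close> by left multiplication are the cosets \<open>\<Gamma>g\<close> with \<open>g \<in> S\<close>.
  A function on an open subset of the quotient is holomorphic iff its pullback to \<open>S\<close> is.
\<close>

definition quotient_S_topology :: "(complex^2^2) set \<Rightarrow> (complex^2^2) set topology" where
  "quotient_S_topology \<Gamma> =
     quotient_topology (top_of_set compression_semigroup) (\<lambda>g. \<Gamma> #>\<^bsub>SL2\<^esub> g)"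

definition quotient_S_holomorphic ::
  "(complex^2^2) set \<Rightarrow> (complex^2^2) set set \<Rightarrow> ((complex^2^2) set \<Rightarrow> complex) \<Rightarrow> bool" where
  "quotient_S_holomorphic \<Gamma> V h \<longleftrightarrow>
     SL2_holomorphic {g \<in> compression_semigroup. \<Gamma> #>\<^bsub>SL2\<^esub> g \<in> V} (\<lambda>g. h (\<Gamma> #>\<^bsub>SL2\<^esub> g))"

definition quotient_G_topology :: "(complex^2^2) set \<Rightarrow> (complex^2^2) set topology" where
  "quotient_G_topology \<Gamma> =
     quotient_topology (top_of_set (carrier SU11)) (\<lambda>g. g <#\<^bsub>SU11\<^esub> \<Gamma>)"

end

theory Submission
  imports Defs "HOL-Complex_Analysis.Conformal_Mappings"
begin

text \<open>
  Holomorphic convexity fails. For \<open>a \<ge> 1\<close> and \<open>c = sqrt (a\<^sup>2 - 1)\<close> the closed holomorphic disc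
  \<open>\<zeta> \<mapsto> ((1/2a, 2c\<zeta>), (0, 2a))\<close>, \<open>\<bar>\<zeta>\<bar> \<le> 1\<close>, lies in \<open>S\<close>. Its boundary lies in \<open>G K'\<close> for a fixed
  compact \<open>K' \<subseteq> S\<close>, and the image of \<open>G K'\<close> in \<open>\<Gamma>\<setminus>S\<close> is compact because \<open>\<Gamma>\<close> is cocompact. By the
  maximum principle the hull of this compact set contains the classes of all centres
  \<open>diag (1/2a, 2a)\<close>. On these the left \<open>G\<close>-invariant function \<open>\<bar>g\<^sub>2\<^sub>2\<bar>\<^sup>2 - \<bar>g\<^sub>1\<^sub>2\<bar>\<^sup>2\<close> is unbounded.
\<close>

section \<open>Two by two matrices\<close>

definition mat2 :: "'a \<Rightarrow> 'a \<Rightarrow> 'a \<Rightarrow> 'a \<Rightarrow> 'a::zero^2^2" where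
  "mat2 a b c d = vector [vector [a, b], vector [c, d]]"

lemma mat2_nth [simp]:
  "mat2 a b c d $ 1 $ 1 = a" "mat2 a b c d $ 1 $ 2 = b"
  "mat2 a b c d $ 2 $ 1 = c" "mat2 a b c d $ 2 $ 2 = d"
  by (simp_all add: mat2_def)

lemma mat2_eq_iff:
  "A = B \<longleftrightarrow> A $ 1 $ 1 = B $ 1 $ 1 \<and> A $ 1 $ 2 = B $ 1 $ 2 \<and> A $ 2 $ 1 = B $ 2 $ 1 \<and> A $ 2 $ 2 = B $ 2 $ 2"
  for A B :: "'a^2^2"
  by (auto simp: vec_eq_iff forall_2)

lemma matrix_mult_2:
  "(A ** B) $ i $ j = A $ i $ 1 * B $ 1 $ j + A $ i $ 2 * B $ 2 $ j"
  for A B :: "'a::semiring_1^2^2"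
  by (simp add: matrix_matrix_mult_def sum_2)

lemma matrix_vector_mult_2:
  "(A *v z) $ i = A $ i $ 1 * z $ 1 + A $ i $ 2 * z $ 2"
  for A :: "'a::semiring_1^2^2"
  by (simp add: matrix_vector_mult_def sum_2)

lemma continuous_on_matrix_mult [continuous_intros]:
  fixes f g :: "'a::topological_space \<Rightarrow> complex^'n::finite^'n"
  assumes "continuous_on S f" "continuous_on S g"
  shows "continuous_on S (\<lambda>x. f x ** g x)"
  unfolding matrix_matrix_mult_def by (intro continuous_intros assms)

text \<open>Puts \<open>mat2\<close> into the shape for which continuity can be checked entry by
  entry.\<close>

lemma mat2_eq_lambda:
  "mat2 a b c d = (\<chi> i j. if i = 1 then if j = 1 then a else b else if j = 1 then c else d)"
  by (simp add: mat2_eq_iff)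

lemma continuous_on_mat2 [continuous_intros]:
  assumes "continuous_on S a" "continuous_on S b" "continuous_on S c" "continuous_on S d"
  shows "continuous_on S (\<lambda>x. mat2 (a x) (b x) (c x) (d x))"
  unfolding mat2_eq_lambda
proof (intro continuous_on_vec_lambda)
  show "continuous_on S (\<lambda>x. if i = 1 then if j = 1 then a x else b x else if j = 1 then c x else d x)"
    for i j :: 2
    using assms by (cases "i = 1"; cases "j = 1") simp_all
qed

text \<open>The adjugate: an explicit inverse for matrices of determinant 1.\<close>

definition adj2 :: "complex^2^2 \<Rightarrow> complex^2^2" where
  "adj2 A = mat2 (A $ 2 $ 2) (- A $ 1 $ 2) (- A $ 2 $ 1) (A $ 1 $ 1)"

lemma adj2_mult:
  assumes "det A = 1"
  shows "adj2 A ** A = mat 1" "A ** adj2 A = mat 1"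
  using assms by (auto simp: adj2_def mat2_eq_iff matrix_mult_2 det_2 mat_def algebra_simps)

text \<open>The entries are only permuted and change sign. Hence a norm bound on an element of
  \<open>SU11\<close> also bounds its inverse.\<close>

lemma norm_adj2: "norm (adj2 A) = norm A"
  by (simp add: adj2_def norm_vec_def L2_set_def sum_2 algebra_simps)

section \<open>The groups\<close>

lemma SL2_simps [simp]:
  "carrier SL2 = {A. det A = 1}" "x \<otimes>\<^bsub>SL2\<^esub> y = x ** y" "\<one>\<^bsub>SL2\<^esub> = mat 1"
  by (simp_all add: SL2_def)

lemma SU11_simps [simp]: "x \<otimes>\<^bsub>SU11\<^esub> y = x ** y" "\<one>\<^bsub>SU11\<^esub> = mat 1"
  by (simp_all add: SU11_def)

lemma carrier_SU11_iff:
  "A \<in> carrier SU11 \<longleftrightarrow> det A = 1 \<and> (\<forall>z w. herm11 (A *v z) (A *v w) = herm11 z w)"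
  by (simp add: SU11_def)

text \<open>Invariance of the form under the inverse is invariance under \<open>A\<close>, read at
  the vectors \<open>adj2 A *v z\<close> and \<open>adj2 A *v w\<close>.\<close>

lemma adj2_SU11:
  assumes "A \<in> carrier SU11"
  shows "adj2 A \<in> carrier SU11"
proof -
  have d: "det A = 1" using assms by (simp add: carrier_SU11_iff)
  then have "det (adj2 A) = 1" by (simp add: adj2_def det_2 algebra_simps)
  moreover have "herm11 (adj2 A *v z) (adj2 A *v w) = herm11 z w" for z w
  proof -
    have "herm11 (adj2 A *v z) (adj2 A *v w) = herm11 (A *v (adj2 A *v z)) (A *v (adj2 A *v w))"
      using assms by (simp add: carrier_SU11_iff)
    then show ?thesis
      by (simp add: matrix_vector_mul_assoc adj2_mult[OF d])
  qed
  ultimately show ?thesis by (simp add: carrier_SU11_iff)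
qed

lemma mult_SU11:
  assumes "A \<in> carrier SU11" "B \<in> carrier SU11"
  shows "A ** B \<in> carrier SU11"
  using assms by (simp add: carrier_SU11_iff det_mul flip: matrix_vector_mul_assoc)

lemma group_SU11: "group SU11"
proof (rule groupI)
  fix x assume "x \<in> carrier SU11"
  then show "\<exists>y\<in>carrier SU11. y \<otimes>\<^bsub>SU11\<^esub> x = \<one>\<^bsub>SU11\<^esub>"
    using adj2_SU11[of x] adj2_mult(1)[of x] by (intro bexI[of _ "adj2 x"]) (simp_all add: carrier_SU11_iff)
qed (simp_all add: mult_SU11 matrix_mul_assoc carrier_SU11_iff[of "mat 1"] det_I)

text \<open>The mixed terms cancel, so a matrix of this shape scales the form by its determinant
  \<open>a * cnj a - b * cnj b\<close>.\<close>

lemma SU11_I: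
  assumes "cmod a ^ 2 - cmod b ^ 2 = 1"
  shows "mat2 a b (cnj b) (cnj a) \<in> carrier SU11"
proof -
  have 1: "a * cnj a - b * cnj b = 1"
    unfolding complex_norm_square[symmetric] of_real_diff[symmetric] assms by simp
  have "herm11 (mat2 a b (cnj b) (cnj a) *v z) (mat2 a b (cnj b) (cnj a) *v w)
     = (a * cnj a - b * cnj b) * herm11 z w" for z w
    by (simp add: herm11_def matrix_vector_mult_2 algebra_simps)
  then show ?thesis
    using 1 by (simp add: carrier_SU11_iff det_2)
qed

lemma herm11_self: "herm11 z z = of_real (cmod (z $ 1) ^ 2 - cmod (z $ 2) ^ 2)"
  by (simp only: herm11_def complex_norm_square of_real_diff)

lemma SU11_preserves_norms:
  assumes "A \<in> carrier SU11"
  shows "cmod ((A *v z) $ 1) ^ 2 - cmod ((A *v z) $ 2) ^ 2 = cmod (z $ 1) ^ 2 - cmod (z $ 2) ^ 2"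
proof -
  have "herm11 (A *v z) (A *v z) = herm11 z z"
    using assms by (simp add: carrier_SU11_iff)
  then show ?thesis
    unfolding herm11_self of_real_eq_iff .
qed

text \<open>The group is cut out by equations between continuous functions of the entries. Its
  intersections with closed balls are therefore compact.\<close>

lemma closed_SU11: "closed (carrier SU11)"
proof -
  have "carrier SU11 = {A. det A = 1} \<inter> (\<Inter>z. \<Inter>w. {A. herm11 (A *v z) (A *v w) = herm11 z w})"
    by (auto simp: carrier_SU11_iff)
  moreover have "closed {A::complex^2^2. det A = 1}"
    unfolding det_2 by (intro closed_Collect_eq continuous_intros)
  moreover have "closed {A. herm11 (A *v z) (A *v w) = herm11 z w}" for z w
    unfolding herm11_def matrix_vector_mult_2 by (intro closed_Collect_eq continuous_intros)
  ultimately show ?thesis by (simp only:) (intro closed_Int closed_INT ballI; simp)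
qed

section \<open>The compression semigroup\<close>

lemma proj_eq_imp: "proj z = proj w \<Longrightarrow> \<exists>c. c \<noteq> 0 \<and> z = c *s w"
proof -
  assume "proj z = proj w"
  moreover have "1 *s z \<in> proj z" unfolding proj_def using one_neq_zero by blast
  ultimately have "z \<in> proj w" by simp
  then show ?thesis by (auto simp: proj_def)
qed

text \<open>\<open>disc\<close> only provides some representative satisfying the inequality;
  rescaling multiplies both moduli by the same factor, so every representative satisfies it.\<close>

lemma proj_in_disc_iff:
  assumes "z \<noteq> 0"
  shows "proj z \<in> disc \<longleftrightarrow> cmod (z $ 1) < cmod (z $ 2)"
proof
  assume "proj z \<in> disc"
  then obtain w where w: "proj z = proj w" "(cmod (w $ 1))\<^sup>2 < (cmod (w $ 2))\<^sup>2"
    by (auto simp: disc_def)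
  from w(2) have "cmod (w $ 1) < cmod (w $ 2)"
    by (simp add: power2_less_imp_less)
  with proj_eq_imp[OF w(1)] show "cmod (z $ 1) < cmod (z $ 2)"
    by (auto simp: norm_mult)
next
  assume "cmod (z $ 1) < cmod (z $ 2)"
  then have "(cmod (z $ 1))\<^sup>2 < (cmod (z $ 2))\<^sup>2"
    by (simp add: power_strict_mono)
  then show "proj z \<in> disc"
    using assms by (auto simp: disc_def)
qed

text \<open>The points with \<open>cmod (z $ 2) < cmod (z $ 1)\<close> form an open subset of
  \<open>P1\<close> disjoint from \<open>disc\<close>.\<close>

lemma closure_of_disc_subset:
  "P1 closure_of disc \<subseteq> {proj z | z. z \<noteq> 0 \<and> cmod (z $ 1) \<le> cmod (z $ 2)}"
proof
  fix p assume p: "p \<in> P1 closure_of disc"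
  then have "p \<in> topspace P1" by (meson closure_of_subset_topspace subsetD)
  then obtain z where z: "z \<noteq> 0" "p = proj z" by (auto simp: P1_def)
  have "cmod (z $ 1) \<le> cmod (z $ 2)"
  proof (rule ccontr)
    assume less: "\<not> ?thesis"
    define V where "V = proj ` {w. cmod (w $ 2) < cmod (w $ 1)}"
    have nz: "w \<noteq> 0" if "cmod (w $ 2) < cmod (w $ 1)" for w :: "complex^2"
      using that by auto
    \<comment> \<open>The cone defining \<open>V\<close> is invariant under scaling, so it is the
      full preimage of \<open>V\<close>; the quotient topology tests openness on that
      preimage.\<close>
    have pre: "proj w \<in> V \<longleftrightarrow> cmod (w $ 2) < cmod (w $ 1)" for w
    proof
      assume "proj w \<in> V"
      then obtain v where "proj w = proj v" "cmod (v $ 2) < cmod (v $ 1)" by (auto simp: V_def)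
      then show "cmod (w $ 2) < cmod (w $ 1)"
        using proj_eq_imp[of w v] by (auto simp: norm_mult)
    qed (auto simp: V_def)
    have "open {w::complex^2. cmod (w $ 2) < cmod (w $ 1)}"
      by (intro open_Collect_less continuous_intros)
    moreover have "{x \<in> - {0}. proj x \<in> V} = {w. cmod (w $ 2) < cmod (w $ 1)}"
      using nz by (auto simp: pre)
    moreover have "V \<subseteq> proj ` (- {0})"
      using nz by (auto simp: V_def)
    ultimately have "openin P1 V"
      using nz by (auto simp: P1_def openin_quotient_topology openin_open_eq[OF open_Compl[OF closed_singleton]])
    moreover have "p \<in> V" using less z by (simp add: pre)
    ultimately obtain q where q: "q \<in> disc" "q \<in> V"
      using p by (auto simp: in_closure_of)
    then obtain w where "w \<noteq> 0" "q = proj w" by (auto simp: disc_def)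
    with q show False by (simp add: pre proj_in_disc_iff)
  qed
  with z show "p \<in> {proj z | z. z \<noteq> 0 \<and> cmod (z $ 1) \<le> cmod (z $ 2)}" by auto
qed

text \<open>A test in homogeneous coordinates. On the closed disc a nonzero vector has
  \<open>z $ 2\<close> nonzero, which is what makes strict estimates possible.\<close>

lemma compression_semigroupI:
  assumes "det g = 1"
    and "\<And>z. z $ 2 \<noteq> 0 \<Longrightarrow> cmod (z $ 1) \<le> cmod (z $ 2) \<Longrightarrow> cmod ((g *v z) $ 1) < cmod ((g *v z) $ 2)"
  shows "g \<in> compression_semigroup"
proof -
  have "proj (g *v z) \<in> disc" if "z \<noteq> 0" "cmod (z $ 1) \<le> cmod (z $ 2)" for z
  proof -
    have "z $ 2 \<noteq> 0" using that by (auto simp: vec_eq_iff forall_2)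
    then have *: "cmod ((g *v z) $ 1) < cmod ((g *v z) $ 2)" using that assms(2) by blast
    then have "g *v z \<noteq> 0" by auto
    with * show ?thesis by (simp add: proj_in_disc_iff)
  qed
  then show ?thesis
    using assms(1) closure_of_disc_subset
    by (fastforce simp: compression_semigroup_def P1_action_proj)
qed

text \<open>\<open>u\<close> preserves the indefinite form, whose sign defines the disc, and so maps
  the disc into itself.\<close>

lemma SU11_mult_compression:
  assumes u: "u \<in> carrier SU11" and g: "g \<in> compression_semigroup"
  shows "u ** g \<in> compression_semigroup"
proof -
  have "P1_action u p \<in> disc" if p: "p \<in> disc" for p
  proof -
    obtain z where z: "p = proj z" "(cmod (z $ 1))\<^sup>2 - (cmod (z $ 2))\<^sup>2 < 0"
      using p unfolding disc_def by blast
    have "(cmod ((u *v z) $ 1))\<^sup>2 - (cmod ((u *v z) $ 2))\<^sup>2 < 0"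
      using z(2) SU11_preserves_norms[OF u, of z] by linarith
    moreover from this have "u *v z \<noteq> 0" by auto
    ultimately show ?thesis by (auto simp: z P1_action_proj disc_def)
  qed
  moreover have "P1_action (u ** g) p = P1_action u (P1_action g p)" for p
    by (simp add: P1_action_def image_image matrix_vector_mul_assoc)
  ultimately show ?thesis
    using u g by (auto simp: compression_semigroup_def carrier_SU11_iff det_mul)
qed

section \<open>Holomorphic functions along affine curves\<close>

text \<open>Chain rule for a local extension \<open>F\<close> in the matrix entries: its derivative
  \<open>D\<close> is complex linear, so along a curve with direction \<open>v\<close> it is
  multiplication by \<open>D v\<close>.\<close>

lemma SL2_holomorphic_affine:
  assumes f: "SL2_holomorphic U f"
    and curve: "\<And>\<zeta>. \<zeta> \<in> T \<Longrightarrow> \<gamma> \<zeta> \<in> U"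
    and affine: "\<And>\<zeta>. entries (\<gamma> \<zeta>) = p + \<zeta> *s v"
  shows "(\<lambda>\<zeta>. f (\<gamma> \<zeta>)) holomorphic_on T"
  unfolding holomorphic_on_def
proof
  fix \<zeta> assume \<zeta>: "\<zeta> \<in> T"
  obtain W F where W: "open W" "entries (\<gamma> \<zeta>) \<in> W" "F vec_holomorphic_on W"
    and F: "\<And>B. B \<in> U \<Longrightarrow> entries B \<in> W \<Longrightarrow> f B = F (entries B)"
    using f[unfolded SL2_holomorphic_def, rule_format, OF curve[OF \<zeta>]] by blast
  obtain D where D: "(F has_derivative D) (at (entries (\<gamma> \<zeta>)))" "\<And>c v. D (c *s v) = c * D v"
    using W by (auto simp: vec_holomorphic_on_def)
  have "linear (\<lambda>h. h *s v)"
    by (rule linearI) (auto simp: vec_eq_iff algebra_simps)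
  then have bl: "bounded_linear (\<lambda>h. h *s v)" by (simp add: linear_conv_bounded_linear)
  have der: "((\<lambda>\<zeta>. entries (\<gamma> \<zeta>)) has_derivative (\<lambda>h. h *s v)) (at \<zeta> within T)"
    unfolding affine using has_derivative_add[OF has_derivative_const bounded_linear_imp_has_derivative[OF bl]]
    by simp
  \<comment> \<open>The affine formula holds for every parameter, also outside \<open>T\<close>, so
    the preimage of \<open>W\<close> is open in the whole plane.\<close>
  have cont: "continuous_on UNIV (\<lambda>\<zeta>. entries (\<gamma> \<zeta>))"
    unfolding affine by (intro continuous_intros linear_continuous_on bl)
  then have "open ((\<lambda>\<zeta>. entries (\<gamma> \<zeta>)) -` W)"
    using W(1) by (simp add: open_vimage)
  then obtain d where d: "d > 0" "\<And>x. dist x \<zeta> < d \<Longrightarrow> entries (\<gamma> x) \<in> W"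
    using W(2) by (force simp: open_dist)
  have "((\<lambda>\<zeta>. F (entries (\<gamma> \<zeta>))) has_derivative (\<lambda>h. D (h *s v))) (at \<zeta> within T)"
    using has_derivative_compose[OF der D(1)] .
  then have "(\<lambda>\<zeta>. F (entries (\<gamma> \<zeta>))) field_differentiable (at \<zeta> within T)"
    unfolding field_differentiable_def has_field_derivative_def
    by (intro exI[of _ "D v"]) (simp add: D(2) mult_commute_abs)
  then show "(\<lambda>\<zeta>. f (\<gamma> \<zeta>)) field_differentiable (at \<zeta> within T)"
    by (rule field_differentiable_transform_within[OF d(1) \<zeta>, rotated])
      (simp add: F curve d)
qed

section \<open>The discs\<close>

text \<open>The parameter enters one off-diagonal entry opposite a zero, so the curve is affine and
  its determinant does not depend on the parameter.\<close>

definition cdisc :: "real \<Rightarrow> real \<Rightarrow> complex \<Rightarrow> complex^2^2" where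
  "cdisc a c \<zeta> = mat2 (of_real (1 / (2 * a))) (of_real (2 * c) * \<zeta>) 0 (of_real (2 * a))"

text \<open>For \<open>cmod q \<le> 1 / 2\<close> these matrices form the compact set
  \<open>K'\<close> of the overview.\<close>

definition lower :: "complex \<Rightarrow> complex^2^2" where
  "lower q = mat2 (1 / 2) 0 q 2"

text \<open>By the triangle inequality it suffices that \<open>1 / (2 * a) + 2 * c < 2 * a\<close>,
  that is, \<open>c < a - 1 / (4 * a)\<close>. The square of the right side exceeds
  \<open>a\<^sup>2 - 1 / 2\<close>, hence \<open>c\<^sup>2\<close>.\<close>

lemma cdisc_in_compression:
  assumes a: "a \<ge> 1" and c: "c \<ge> 0" "c\<^sup>2 = a\<^sup>2 - 1" and \<zeta>: "cmod \<zeta> \<le> 1"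
  shows "cdisc a c \<zeta> \<in> compression_semigroup"
proof (rule compression_semigroupI)
  show "det (cdisc a c \<zeta>) = 1" using a by (simp add: cdisc_def det_2)
  fix z :: "complex^2" assume z: "z $ 2 \<noteq> 0" "cmod (z $ 1) \<le> cmod (z $ 2)"
  have pos: "cmod (z $ 2) > 0" using z by simp
  have "c < a - 1 / (4 * a)"
  proof (rule power2_less_imp_less)
    have "(a - 1 / (4 * a))\<^sup>2 = a\<^sup>2 - 1 / 2 + (1 / (4 * a))\<^sup>2"
      using a by (simp add: power2_eq_square field_simps)
    then show "c\<^sup>2 < (a - 1 / (4 * a))\<^sup>2" unfolding c(2) using zero_le_power2[of "1 / (4 * a)"] by linarith
    have "1 / (4 * a) \<le> 1" using a by (simp add: field_simps)
    then show "0 \<le> a - 1 / (4 * a)" using a by linarith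
  qed
  then have less: "1 / (2 * a) + 2 * c < 2 * a" by (simp add: field_simps)
  have "cmod ((cdisc a c \<zeta> *v z) $ 1)
      \<le> cmod (of_real (1 / (2 * a)) * z $ 1) + cmod (of_real (2 * c) * \<zeta> * z $ 2)"
    by (simp add: cdisc_def matrix_vector_mult_2 norm_triangle_ineq)
  also have "\<dots> = 1 / (2 * a) * cmod (z $ 1) + 2 * c * (cmod \<zeta> * cmod (z $ 2))"
    using a c by (simp add: norm_mult norm_divide)
  also have "\<dots> \<le> 1 / (2 * a) * cmod (z $ 2) + 2 * c * (1 * cmod (z $ 2))"
    using a c z \<zeta> by (intro add_mono mult_left_mono mult_right_mono) auto
  also have "\<dots> = (1 / (2 * a) + 2 * c) * cmod (z $ 2)" by (simp add: algebra_simps)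
  also have "\<dots> < 2 * a * cmod (z $ 2)"
    using less pos by (rule mult_strict_right_mono)
  also have "\<dots> = cmod ((cdisc a c \<zeta> *v z) $ 2)"
    using a by (simp add: cdisc_def matrix_vector_mult_2 norm_mult)
  finally show "cmod ((cdisc a c \<zeta> *v z) $ 1) < cmod ((cdisc a c \<zeta> *v z) $ 2)" .
qed

lemma lower_in_compression:
  assumes "cmod q \<le> 1 / 2"
  shows "lower q \<in> compression_semigroup"
proof (rule compression_semigroupI)
  show "det (lower q) = 1" by (simp add: lower_def det_2)
  fix z :: "complex^2" assume z: "z $ 2 \<noteq> 0" "cmod (z $ 1) \<le> cmod (z $ 2)"
  have "cmod (q * z $ 1) \<le> 1 / 2 * cmod (z $ 2)"
    unfolding norm_mult using assms z by (intro mult_mono) auto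
  \<comment> \<open>Reverse triangle inequality: the second coordinate of the image has modulus at
    least \<open>3 / 2 * cmod (z $ 2)\<close>, while the first has at most a third of that.\<close>
  moreover have "cmod (2 * z $ 2) \<le> cmod (q * z $ 1 + 2 * z $ 2) + cmod (q * z $ 1)"
    using norm_triangle_ineq4[of "q * z $ 1 + 2 * z $ 2" "q * z $ 1"] by simp
  moreover have "cmod (z $ 2) > 0" using z by simp
  ultimately have "cmod (z $ 1) / 2 < cmod (q * z $ 1 + 2 * z $ 2)"
    unfolding norm_mult[of 2] norm_numeral using z by linarith
  then show "cmod ((lower q *v z) $ 1) < cmod ((lower q *v z) $ 2)"
    by (simp add: lower_def matrix_vector_mult_2 norm_divide)
qed

text \<open>On the unit circle \<open>a\<close> and \<open>of_real c * \<zeta>\<close> form the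
  first row of an element \<open>u\<close> of \<open>SU11\<close>, because
  \<open>a\<^sup>2 - c\<^sup>2 = 1\<close>. Doubling the second column of \<open>u\<close> gives
  that of the disc, so only the first column needs adjusting.\<close>

lemma cdisc_boundary:
  assumes a: "a \<ge> 1" and c: "c \<ge> 0" "c\<^sup>2 = a\<^sup>2 - 1" and \<zeta>: "cmod \<zeta> = 1"
  shows "\<exists>u q. u \<in> carrier SU11 \<and> cmod q \<le> 1 / 2 \<and> cdisc a c \<zeta> = u ** lower q"
proof (intro exI conjI)
  define u where "u = mat2 (of_real a) (of_real c * \<zeta>) (cnj (of_real c * \<zeta>)) (cnj (of_real a))"
  \<comment> \<open>The unique \<open>q\<close> for which the lower left entry of
    \<open>u ** lower q\<close> vanishes; its modulus is \<open>c / (2 * a)\<close>.\<close>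
  define q where "q = - of_real (c / (2 * a)) * cnj \<zeta>"
  show "u \<in> carrier SU11"
    unfolding u_def using \<zeta> c by (intro SU11_I) (simp add: norm_mult)
  have "c \<le> a" using a c by (intro power2_le_imp_le[of c a]) auto
  then show "cmod q \<le> 1 / 2"
    using a c \<zeta> by (simp add: q_def norm_mult norm_divide field_simps)
  have \<zeta>2: "\<zeta> * cnj \<zeta> = 1" using \<zeta> by (simp flip: complex_norm_square)
  have "a / 2 - c\<^sup>2 / (2 * a) = 1 / (2 * a)"
    unfolding c(2) using a by (simp add: power2_eq_square field_simps)
  then have "of_real (a / 2 - c\<^sup>2 / (2 * a)) = (of_real (1 / (2 * a)) :: complex)"
    by (rule arg_cong)
  moreover have "of_real c * \<zeta> * q = - of_real (c\<^sup>2 / (2 * a)) * (\<zeta> * cnj \<zeta>)"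
    by (simp add: q_def power2_eq_square)
  ultimately have 1: "of_real a * (1 / 2) + of_real c * \<zeta> * q = of_real (1 / (2 * a))"
    by (simp add: \<zeta>2)
  have 2: "cnj (of_real c * \<zeta>) * (1 / 2) + of_real a * q = 0"
    using a by (simp add: q_def)
  show "cdisc a c \<zeta> = u ** lower q"
    using 1 2 by (simp add: mat2_eq_iff cdisc_def lower_def u_def matrix_mult_2)
qed

section \<open>The quotients\<close>

lemma subgroup_SU11_adj2:
  assumes "subgroup \<Gamma> SU11" "\<gamma> \<in> \<Gamma>"
  shows "adj2 \<gamma> \<in> \<Gamma>"
proof -
  have \<gamma>: "\<gamma> \<in> carrier SU11" using assms subgroup.subset by blast
  then have "adj2 \<gamma> \<otimes>\<^bsub>SU11\<^esub> \<gamma> = \<one>\<^bsub>SU11\<^esub>"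
    by (simp add: adj2_mult carrier_SU11_iff)
  then have "inv\<^bsub>SU11\<^esub> \<gamma> = adj2 \<gamma>"
    using \<gamma> adj2_SU11[OF \<gamma>] group.inv_equality[OF group_SU11] by blast
  then show ?thesis
    using subgroup.m_inv_closed[OF assms] by simp
qed

lemma SU11_det: "A \<in> carrier SU11 \<Longrightarrow> det A = 1"
  by (simp add: carrier_SU11_iff)

text \<open>The images of open norm balls cover the compact quotient, so a single radius suffices.
  Compactness concerns cosets with \<Gamma> on the right, while the conclusion has \<Gamma> on the
  left; inversion exchanges the sides.\<close>

lemma cocompact_imp_compact_fundamental_set:
  assumes sub: "subgroup \<Gamma> SU11" and cpt: "compact_space (quotient_G_topology \<Gamma>)"
  obtains C where "compact C" "C \<subseteq> carrier SU11"
    "\<forall>g\<in>carrier SU11. \<exists>\<gamma>\<in>\<Gamma>. \<exists>h\<in>C. g = \<gamma> ** h"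
proof -
  let ?G = "carrier SU11" and ?q = "\<lambda>g. g <#\<^bsub>SU11\<^esub> \<Gamma>"
  have coset: "?q g = {g ** h | h. h \<in> \<Gamma>}" for g by (auto simp: l_coset_def)
  have \<Gamma>: "\<Gamma> \<subseteq> ?G" using subgroup.subset[OF sub] .
  have self: "g \<in> ?q g" for g
    using subgroup.one_closed[OF sub] by (force simp: coset)
  have closed: "\<gamma> ** \<delta> \<in> \<Gamma>" if "\<gamma> \<in> \<Gamma>" "\<delta> \<in> \<Gamma>" for \<gamma> \<delta>
    using subgroup.m_closed[OF sub that] by simp
  have absorb: "?q (g ** \<gamma>) = ?q g" if \<gamma>: "\<gamma> \<in> \<Gamma>" for g \<gamma>
  proof (intro equalityI subsetI)
    fix x assume "x \<in> ?q (g ** \<gamma>)"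
    then obtain \<delta> where \<delta>: "\<delta> \<in> \<Gamma>" "x = g ** \<gamma> ** \<delta>" unfolding coset by blast
    then have "x = g ** (\<gamma> ** \<delta>)" by (simp only: matrix_mul_assoc)
    with closed[OF \<gamma> \<delta>(1)] show "x \<in> ?q g" unfolding coset by blast
  next
    fix x assume "x \<in> ?q g"
    then obtain \<delta> where \<delta>: "\<delta> \<in> \<Gamma>" "x = g ** \<delta>" unfolding coset by blast
    have "\<gamma> ** (adj2 \<gamma> ** \<delta>) = \<delta>"
      using \<gamma> \<Gamma> by (simp add: matrix_mul_assoc adj2_mult SU11_det subsetD)
    then have "x = g ** \<gamma> ** (adj2 \<gamma> ** \<delta>)"
      unfolding \<delta>(2) by (simp only: flip: matrix_mul_assoc)
    moreover have "adj2 \<gamma> ** \<delta> \<in> \<Gamma>"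
      using closed subgroup_SU11_adj2[OF sub \<gamma>] \<delta> by blast
    ultimately show "x \<in> ?q (g ** \<gamma>)" unfolding coset by blast
  qed
  define V where "V = (\<lambda>n::nat. ?q ` {g \<in> ?G. norm g < n})"
  have "openin (quotient_G_topology \<Gamma>) (V n)" for n
  proof -
    \<comment> \<open>The saturation of a ball is the union of its right translates by \<Gamma>,
      each relatively open.\<close>
    have "{x \<in> ?G. ?q x \<in> V n} = (\<Union>\<gamma>\<in>\<Gamma>. ?G \<inter> (\<lambda>x. x ** \<gamma>) -` ball 0 n)" (is "?L = ?R")
    proof (intro equalityI subsetI)
      fix x assume x: "x \<in> ?L"
      then obtain g where g: "g \<in> ?G" "norm g < n" "?q x = ?q g" by (auto simp: V_def)
      then obtain \<gamma> where "\<gamma> \<in> \<Gamma>" "g = x ** \<gamma>"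
        using self[of g] unfolding \<open>?q x = ?q g\<close> [symmetric] coset by blast
      moreover have "x \<in> ?G" using x by blast
      ultimately show "x \<in> ?R" using g(2) by auto
    next
      fix x assume "x \<in> ?R"
      then obtain \<gamma> where "x \<in> ?G" "\<gamma> \<in> \<Gamma>" "norm (x ** \<gamma>) < n" by auto
      moreover from this have "x ** \<gamma> \<in> ?G" using \<Gamma> by (intro mult_SU11) auto
      ultimately have "?q (x ** \<gamma>) \<in> V n" unfolding V_def by blast
      then show "x \<in> ?L" using \<open>x \<in> ?G\<close> absorb[OF \<open>\<gamma> \<in> \<Gamma>\<close>] by simp
    qed
    moreover have "openin (top_of_set ?G) (?G \<inter> (\<lambda>x. x ** \<gamma>) -` ball 0 n)" for \<gamma> :: "complex^2^2"
      by (intro continuous_openin_preimage_gen continuous_intros open_ball)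
    ultimately have "openin (top_of_set ?G) {x \<in> ?G. ?q x \<in> V n}" by (simp only:) (blast intro: openin_Union)
    moreover have "V n \<subseteq> ?q ` ?G" by (auto simp: V_def)
    ultimately show ?thesis by (simp add: quotient_G_topology_def openin_quotient_topology)
  qed
  moreover have "topspace (quotient_G_topology \<Gamma>) \<subseteq> \<Union> (range V)"
  proof
    fix p assume "p \<in> topspace (quotient_G_topology \<Gamma>)"
    then obtain g where "g \<in> ?G" "p = ?q g" by (auto simp: quotient_G_topology_def)
    moreover obtain n :: nat where "norm g < n" using reals_Archimedean2 by blast
    ultimately show "p \<in> \<Union> (range V)" by (auto simp: V_def)
  qed
  ultimately obtain \<F> where \<F>: "finite \<F>" "\<F> \<subseteq> range V" "topspace (quotient_G_topology \<Gamma>) \<subseteq> \<Union>\<F>"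
    using cpt[unfolded compact_space_alt, rule_format, of "range V"] by blast
  then obtain I where I: "finite I" "\<F> = V ` I"
    using finite_subset_image[OF \<F>(1,2)] by blast
  then obtain m where m: "\<And>i. i \<in> I \<Longrightarrow> i \<le> m"
    unfolding finite_nat_set_iff_bounded_le by blast
  show thesis
  proof (rule that; (intro ballI)?)
    show "compact (?G \<inter> cball 0 m)"
      using closed_SU11 by (simp add: closed_Int_compact)
    fix g assume g: "g \<in> ?G"
    \<comment> \<open>The covering is applied to the inverse of \<open>g\<close>: from
      \<open>h = adj2 g ** \<gamma>\<close> follows \<open>g = \<gamma> ** adj2 h\<close>, with
      \<open>adj2 h\<close> as short as \<open>h\<close>.\<close>
    have "?q (adj2 g) \<in> topspace (quotient_G_topology \<Gamma>)"
      using adj2_SU11[OF g] by (simp add: quotient_G_topology_def)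
    then obtain i where i: "i \<in> I" "?q (adj2 g) \<in> V i" using \<F>(3) I by blast
    then obtain h where h: "h \<in> ?G" "norm h < i" "?q (adj2 g) = ?q h"
      by (auto simp: V_def)
    then obtain \<gamma> where \<gamma>: "\<gamma> \<in> \<Gamma>" "h = adj2 g ** \<gamma>"
      using self[of h] unfolding h(3)[symmetric] coset by blast
    have "\<gamma> = g ** h"
      using g by (simp add: \<gamma> matrix_mul_assoc adj2_mult SU11_det)
    then have "g = \<gamma> ** adj2 h"
      using h by (simp add: adj2_mult SU11_det flip: matrix_mul_assoc)
    moreover have "adj2 h \<in> ?G \<inter> cball 0 m"
      using h m[OF i(1)] adj2_SU11[OF h(1)] by (simp add: norm_adj2)
    ultimately show "\<exists>\<gamma>\<in>\<Gamma>. \<exists>h\<in>?G \<inter> cball 0 m. g = \<gamma> ** h" using \<gamma> by blast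
  qed simp
qed

text \<open>The coset is formed in \<open>SL2\<close>, whereas \<Gamma> is given as a subgroup of
  \<open>SU11\<close>, so both inclusions are checked on elements.\<close>

lemma r_coset_absorb:
  assumes sub: "subgroup \<Gamma> SU11" and \<gamma>: "\<gamma> \<in> \<Gamma>"
  shows "\<Gamma> #>\<^bsub>SL2\<^esub> (\<gamma> ** g) = \<Gamma> #>\<^bsub>SL2\<^esub> g"
proof (intro equalityI subsetI)
  fix x assume "x \<in> \<Gamma> #>\<^bsub>SL2\<^esub> (\<gamma> ** g)"
  then obtain \<delta> where "\<delta> \<in> \<Gamma>" "x = (\<delta> ** \<gamma>) ** g" by (auto simp: r_coset_def matrix_mul_assoc)
  then show "x \<in> \<Gamma> #>\<^bsub>SL2\<^esub> g"
    using subgroup.m_closed[OF sub _ \<gamma>] by (auto simp: r_coset_def)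
next
  fix x assume "x \<in> \<Gamma> #>\<^bsub>SL2\<^esub> g"
  then obtain \<delta> where \<delta>: "\<delta> \<in> \<Gamma>" "x = \<delta> ** g" by (auto simp: r_coset_def)
  have "\<delta> = (\<delta> ** adj2 \<gamma>) ** \<gamma>"
    using \<gamma> subgroup.subset[OF sub]
    by (simp add: adj2_mult SU11_det subsetD flip: matrix_mul_assoc)
  then have "x = (\<delta> ** adj2 \<gamma>) ** (\<gamma> ** g)"
    using \<delta> by (simp add: matrix_mul_assoc)
  moreover have "\<delta> ** adj2 \<gamma> \<in> \<Gamma>"
    using subgroup.m_closed[OF sub \<delta>(1) subgroup_SU11_adj2[OF sub \<gamma>]] by simp
  ultimately show "x \<in> \<Gamma> #>\<^bsub>SL2\<^esub> (\<gamma> ** g)" by (auto simp: r_coset_def)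
qed

text \<open>Minus the Hermitian form evaluated on the second column.\<close>

definition column_norm :: "complex^2^2 \<Rightarrow> real" where
  "column_norm g = (cmod (g $ 2 $ 2))\<^sup>2 - (cmod (g $ 1 $ 2))\<^sup>2"

lemma column_norm_SU11:
  assumes "u \<in> carrier SU11"
  shows "column_norm (u ** g) = column_norm g"
proof -
  let ?z = "vector [g $ 1 $ 2, g $ 2 $ 2] :: complex^2"
  have "(u ** g) $ i $ 2 = (u *v ?z) $ i" for i
    by (simp add: matrix_mult_2 matrix_vector_mult_2)
  then show ?thesis
    using SU11_preserves_norms[OF assms, of ?z] by (simp add: column_norm_def)
qed

text \<open>By left invariance \<open>column_norm\<close> descends to a continuous function on the
  quotient, which is bounded on compact sets.\<close>

lemma bounded_column_norm:
  assumes sub: "subgroup \<Gamma> SU11" and H: "compactin (quotient_S_topology \<Gamma>) H"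
  shows "\<exists>B. \<forall>g. \<Gamma> #>\<^bsub>SL2\<^esub> g \<in> H \<longrightarrow> column_norm g \<le> B"
proof -
  let ?\<pi> = "\<lambda>g. \<Gamma> #>\<^bsub>SL2\<^esub> g" and ?S = compression_semigroup
  \<comment> \<open>The descended function; invariance makes its value independent of the chosen
    representative.\<close>
  define N where "N = (\<lambda>p. column_norm (SOME g. g \<in> p))"
  have N: "N (?\<pi> g) = column_norm g" for g
  proof -
    have "g \<in> ?\<pi> g"
      using subgroup.one_closed[OF sub] by (force simp: r_coset_def)
    then have "(SOME h. h \<in> ?\<pi> g) \<in> ?\<pi> g" by (rule someI)
    then obtain \<gamma> where "\<gamma> \<in> \<Gamma>" "(SOME h. h \<in> ?\<pi> g) = \<gamma> ** g"
      by (auto simp: r_coset_def)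
    then show ?thesis
      using subgroup.subset[OF sub] by (auto simp: N_def column_norm_SU11)
  qed
  have "continuous_on ?S column_norm"
    unfolding column_norm_def by (intro continuous_intros)
  then have "continuous_map (top_of_set ?S) euclidean (N \<circ> ?\<pi>)"
    by (simp add: comp_def N)
  then have "continuous_map (quotient_S_topology \<Gamma>) euclidean N"
    unfolding quotient_S_topology_def
    by (rule continuous_compose_quotient_map[OF quotient_map_quotient_topology])
  then have "compact (N ` H)"
    using image_compactin[OF H] compactin_euclidean_iff by blast
  then obtain B where B: "\<And>x. x \<in> N ` H \<Longrightarrow> norm x \<le> B"
    using compact_imp_bounded[of "N ` H"] unfolding bounded_iff by metis
  have "column_norm g \<le> B" if "?\<pi> g \<in> H" for g
    using B[OF imageI[OF that]] unfolding N by simp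
  then show ?thesis by (intro exI allI impI)
qed

text \<open>The whole closed disc lies in the semigroup, so \<open>f\<close> restricts to a
  holomorphic function of \<zeta> there and the maximum modulus principle applies.\<close>

lemma cdisc_max_principle:
  assumes f: "SL2_holomorphic compression_semigroup f"
    and a: "a \<ge> 1" and c: "c \<ge> 0" "c\<^sup>2 = a\<^sup>2 - 1"
  shows "\<exists>\<zeta>. cmod \<zeta> = 1 \<and> cmod (f (cdisc a c 0)) \<le> cmod (f (cdisc a c \<zeta>))"
proof -
  let ?h = "\<lambda>\<zeta>. f (cdisc a c \<zeta>)"
  have hol: "?h holomorphic_on cball 0 1"
  proof (rule SL2_holomorphic_affine[OF f])
    show "cdisc a c \<zeta> \<in> compression_semigroup" if "\<zeta> \<in> cball 0 1" for \<zeta>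
      using that cdisc_in_compression[OF a c] by simp
    show "entries (cdisc a c \<zeta>) = entries (cdisc a c 0) + \<zeta> *s entries (mat2 0 (of_real (2 * c)) 0 0)" for \<zeta>
      by (simp add: vec_eq_iff entries_def split_paired_All forall_2 cdisc_def)
  qed
  then have cont: "continuous_on (cball 0 1) ?h"
    by (rule holomorphic_on_imp_continuous_on)
  have "continuous_on (sphere 0 1) (\<lambda>\<zeta>. cmod (?h \<zeta>))"
    by (intro continuous_intros continuous_on_subset[OF cont]) auto
  \<comment> \<open>Compactness of the circle yields a point where the modulus is maximal, so the
    bound at the centre is by an actual value.\<close>
  then obtain \<zeta> where \<zeta>: "\<zeta> \<in> sphere 0 1" "\<And>w. w \<in> sphere 0 1 \<Longrightarrow> cmod (?h w) \<le> cmod (?h \<zeta>)"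
    using continuous_attains_sup[of "sphere 0 1" "\<lambda>\<zeta>. cmod (?h \<zeta>)"] by auto
  have "cmod (?h 0) \<le> cmod (?h \<zeta>)"
  proof (rule maximum_modulus_frontier[of ?h "cball 0 1"])
    show "?h holomorphic_on interior (cball 0 1)"
      using hol by (rule holomorphic_on_subset) (rule interior_subset)
  qed (use cont \<zeta> in auto)
  with \<zeta> show ?thesis by auto
qed

theorem proposition3p2:
  fixes \<Gamma> :: "(complex^2^2) set"
  assumes "subgroup \<Gamma> SU11"
    and "discrete \<Gamma>"
    and "compact_space (quotient_G_topology \<Gamma>)"
  shows "\<not> stein_manifold TYPE(3) (quotient_S_topology \<Gamma>) (quotient_S_holomorphic \<Gamma>)"
proof
  assume stein: "stein_manifold TYPE(3) (quotient_S_topology \<Gamma>) (quotient_S_holomorphic \<Gamma>)"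
  let ?S = compression_semigroup and ?X = "quotient_S_topology \<Gamma>" and ?\<pi> = "\<lambda>g. \<Gamma> #>\<^bsub>SL2\<^esub> g"
  obtain C where C: "compact C" "C \<subseteq> carrier SU11"
    and fund: "\<forall>g\<in>carrier SU11. \<exists>\<gamma>\<in>\<Gamma>. \<exists>h\<in>C. g = \<gamma> ** h"
    by (rule cocompact_imp_compact_fundamental_set[OF assms(1,3)])
  \<comment> \<open>A compact set of representatives: every \<open>u ** lower q\<close> with
    \<open>u\<close> in \<open>SU11\<close> and \<open>cmod q \<le> 1 / 2\<close> has its class in
    the image of \<open>M\<close>.\<close>
  define M where "M = (\<lambda>(h, q). h ** lower q) ` (C \<times> cball 0 (1 / 2))"
  have "continuous_on (C \<times> cball 0 (1 / 2)) (\<lambda>(h, q). h ** lower q)"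
    unfolding case_prod_unfold lower_def by (intro continuous_intros)
  then have "compact M"
    unfolding M_def using C by (intro compact_continuous_image compact_Times) auto
  moreover have "M \<subseteq> ?S"
    using C by (auto simp: M_def intro!: SU11_mult_compression lower_in_compression)
  ultimately have "compactin (top_of_set ?S) M"
    by (simp add: compactin_subtopology)
  then have "compactin ?X (?\<pi> ` M)"
    unfolding quotient_S_topology_def
    by (rule image_compactin) (rule quotient_imp_continuous_map[OF quotient_map_quotient_topology])
  then have "compactin ?X (holomorphic_hull ?X (quotient_S_holomorphic \<Gamma>) (?\<pi> ` M))"
    using stein by (auto simp: stein_manifold_def holomorphically_convex_def)
  from bounded_column_norm[OF assms(1) this] obtain B where
    B: "\<And>g. ?\<pi> g \<in> holomorphic_hull ?X (quotient_S_holomorphic \<Gamma>) (?\<pi> ` M) \<Longrightarrow> column_norm g \<le> B"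
    by blast
  \<comment> \<open>The centre \<open>cdisc a c 0\<close> has column norm
    \<open>4 * a\<^sup>2\<close>; this choice makes it exceed \<open>B\<close> and also ensures
    \<open>a \<ge> 1\<close>.\<close>
  define a where "a = 1 + \<bar>B\<bar>"
  define c where "c = sqrt (a\<^sup>2 - 1)"
  have a: "a \<ge> 1" by (simp add: a_def)
  have c: "c \<ge> 0" "c\<^sup>2 = a\<^sup>2 - 1" using a by (simp_all add: c_def)
  have "?\<pi> (cdisc a c 0) \<in> holomorphic_hull ?X (quotient_S_holomorphic \<Gamma>) (?\<pi> ` M)"
    unfolding holomorphic_hull_def
  proof (intro CollectI conjI allI impI)
    show "?\<pi> (cdisc a c 0) \<in> topspace ?X"
      using cdisc_in_compression[OF a c, of 0] by (simp add: quotient_S_topology_def)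
    fix f assume f: "quotient_S_holomorphic \<Gamma> (topspace ?X) f"
    have "{g \<in> ?S. ?\<pi> g \<in> topspace ?X} = ?S" by (auto simp: quotient_S_topology_def)
    with f have "SL2_holomorphic ?S (\<lambda>g. f (?\<pi> g))" by (simp add: quotient_S_holomorphic_def)
    from cdisc_max_principle[OF this a c] obtain \<zeta>
      where \<zeta>: "cmod \<zeta> = 1" "cmod (f (?\<pi> (cdisc a c 0))) \<le> cmod (f (?\<pi> (cdisc a c \<zeta>)))" by blast
    obtain u q where u: "u \<in> carrier SU11" "cmod q \<le> 1 / 2" "cdisc a c \<zeta> = u ** lower q"
      using cdisc_boundary[OF a c \<zeta>(1)] by blast
    \<comment> \<open>The factor \<open>u\<close> varies with \<open>a\<close>, but modulo \<Gamma>
      it may be replaced by an element of the fixed compact set \<open>C\<close>.\<close>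
    obtain \<gamma> h where \<gamma>: "\<gamma> \<in> \<Gamma>" "h \<in> C" "u = \<gamma> ** h" using fund u(1) by blast
    have "?\<pi> (cdisc a c \<zeta>) = ?\<pi> (h ** lower q)"
      using r_coset_absorb[OF assms(1) \<gamma>(1), of "h ** lower q"] by (simp add: u \<gamma> matrix_mul_assoc)
    moreover have "h ** lower q \<in> M" using \<gamma> u by (force simp: M_def)
    ultimately have "?\<pi> (cdisc a c \<zeta>) \<in> ?\<pi> ` M" by blast
    then have "ereal (cmod (f (?\<pi> (cdisc a c \<zeta>)))) \<le> (SUP y\<in>?\<pi> ` M. ereal (cmod (f y)))"
      by (rule SUP_upper)
    then show "ereal (cmod (f (?\<pi> (cdisc a c 0)))) \<le> (SUP y\<in>?\<pi> ` M. ereal (cmod (f y)))"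
      using \<zeta>(2) by (meson ereal_less_eq(3) order_trans)
  qed
  then have "4 * a\<^sup>2 \<le> B"
    using B[of "cdisc a c 0"] a by (simp add: column_norm_def cdisc_def norm_mult power_mult_distrib)
  moreover have "a \<le> a\<^sup>2" using a by (simp add: power2_eq_square)
  ultimately show False using a by (simp add: a_def)
qed

end
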